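(* For every finite labeled graph $F$ with $|V(F)| \geq 3$, for all $p \in (0,1)$, and for all $0 < \delta \leq \min\{p, 1-p\}$, there exists a kernel $\Delta = \Delta(F,p,\delta): [0,1]^2 \to [-\delta, \delta]$ such that \begin{itemize} \item $\rho(\Delta) = 0$, and hence $\rho(W_p + \Delta) = \rho(W_p) = p$; \item $\rho_F(W_p + \Delta) > \rho_F(W_p) = \operatorname{rand}(F,p)$. \end{itemize}
   Context: Graphs are finite and simple. A kernel is a bounded symmetric measurable function $W:[0,1]^2 \to \mathbb{R}$; a graphon is a kernel with values in $[0,1]$. For $p\in[0,1]$, $W_p$ denotes the constant graphon $W_p \equiv p$. For a kernel $W$, $\rho(W) = \int_{[0,1]^2} W(x_1,x_2)\,dx_1\,dx_2$. Let $F$ be a finite labeled graph with vertex set identified with $[m]=\{1,\dots,m\}$, edge set $E$, and set of non-edges $\overline{E} = \binom{[m]}{2}\setminus E$. For a kernel $W$, $$\rho_F(W) = \int_{[0,1]^m} \prod_{e \in E} W(x_{e_1},x_{e_2}) \prod_{f \in \overline{E}}(1 - W(x_{f_1},x_{f_2})) \,dx_1\cdots dx_m,$$ where $e_1,e_2$ denote the two endpoints of $e$. Also $\operatorname{rand}(F,p) = p^{|E|}(1-p)^{\binom{m}{2}-|E|}$. *)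

theory Defs
  imports "HOL-Analysis.Analysis" "HOL-Library.Ramsey"
begin

abbreviation unit_square :: "(real \<times> real) set" where
  "unit_square \<equiv> {0..1} \<times> {0..1}"

text \<open>
  A kernel is represented by a function on the whole plane of which only the restriction to
  the unit square matters. Measurability is Borel measurability, matching the product of
  Borel-Lebesgue measures used for the densities.
\<close>

definition graphon_kernel :: "(real \<times> real \<Rightarrow> real) \<Rightarrow> bool" where
  "graphon_kernel W \<longleftrightarrow>
     W \<in> borel_measurable (restrict_space borel unit_square) \<and>
     bounded (W ` unit_square) \<and>
     (\<forall>x\<in>{0..1}. \<forall>y\<in>{0..1}. W (x, y) = W (y, x))"

definition const_graphon :: "real \<Rightarrow> real \<times> real \<Rightarrow> real" where
  "const_graphon p = (\<lambda>_. p)"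

definition edge_density :: "(real \<times> real \<Rightarrow> real) \<Rightarrow> real" where
  "edge_density W = (LINT z:unit_square|lborel. W z)"

text \<open>
  A simple graph with vertex set \<open>{1..m}\<close> is given by its edge set \<open>E \<subseteq> nsets {1..m} 2\<close>.
  The two endpoints of \<open>e \<in> nsets {1..m} 2\<close> are \<open>Min e\<close> and \<open>Max e\<close>; their order is
  immaterial for a symmetric \<open>W\<close>.
\<close>

definition induced_density :: "nat \<Rightarrow> nat set set \<Rightarrow> (real \<times> real \<Rightarrow> real) \<Rightarrow> real" where
  "induced_density m E W =
     (LINT x:({1..m} \<rightarrow>\<^sub>E {0..1})|(\<Pi>\<^sub>M i\<in>{1..m}. lborel).
        (\<Prod>e\<in>E. W (x (Min e), x (Max e))) *
        (\<Prod>f\<in>nsets {1..m} 2 - E. 1 - W (x (Min f), x (Max f))))"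

definition rand_density :: "nat \<Rightarrow> nat set set \<Rightarrow> real \<Rightarrow> real" where
  "rand_density m E p = p ^ card E * (1 - p) ^ ((m choose 2) - card E)"

end

theory Submission
  imports Defs "HOL-Computational_Algebra.Primes"
begin

text \<open>
  Write \<open>W\<^sub>p + \<Delta>\<close> on an edge and its complement on a non-edge as \<open>q e + \<kappa> e * cos \<alpha>\<close>, with
  \<open>\<kappa> e = \<delta>\<close> or \<open>-\<delta>\<close>. Expanding the product over all pairs of vertices and each cosine into
  two exponentials turns the induced density into a sum over sign patterns
  \<open>s : pairs \<rightarrow> {-1, 0, 1}\<close>, where the pattern \<open>s\<close> carries a weight depending on \<open>F\<close>, \<open>p\<close>, \<open>\<delta>\<close> only,
  times the mean of \<open>exp (i \<Sum>\<^sub>e s e \<alpha> e)\<close>. The pattern \<open>0\<close> contributes \<open>rand(F, p)\<close>. Weights of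
  different patterns that come from isomorphic subgraphs may cancel, so no small subgraph (cherry,
  triangle, four-cycle, \<dots>) can be relied upon to give a gain for every \<open>F\<close>. The complete graph
  \<open>K\<^sub>m\<close>, however, occurs only once, and its coefficient \<open>\<Prod>\<^sub>e \<kappa> e\<close> never vanishes. The
  kernel is therefore chosen so that \<open>K\<^sub>m\<close> dominates every other pattern.

  This is achieved by a quadratic phase. Put \<open>d = m - 1\<close>, let \<open>N\<close> be a large prime, and label the
  parts of an equipartition of \<open>[0,1]\<close> by pairs \<open>(a, b)\<close> with \<open>a < d N\<close> and \<open>b < N\<close>. On the part
  indexed by \<open>(a, b), (a', b')\<close> the kernel \<open>\<Delta>\<close> is \<open>\<delta> cos (2 \<pi> \<phi> + \<theta>)\<close> with
  \<open>\<phi> = (a (b + d b') + a' (b' + d b)) / N + (a + a') / d\<close>.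
  The phase is linear in the \<open>a\<close>-coordinates, so averaging over them leaves exactly the proportion
  of those \<open>b\<close> that solve a system of linear congruences, one for each vertex. Modulo \<open>N\<close> the
  system is homogeneous, and its matrix has the signed degrees of \<open>s\<close> on the diagonal and \<open>d s\<close>
  off it. For \<open>s\<close> constantly \<open>1\<close> or \<open>-1\<close> all its entries are equal: its rank is one, and
  the proportion is at least \<open>1 / N\<close> (\<open>card_twist_solutions_const_ge\<close>). For any other nonzero \<open>s\<close>
  some two rows \<open>v\<close>, \<open>w\<close> with \<open>s {v, w} \<noteq> 0\<close> are independent, because
  \<open>deg v * deg w = d\<^sup>2\<close> along all edges of \<open>s\<close> would force \<open>s\<close> to be constant; hence the
  proportion is at most \<open>1 / N\<^sup>2\<close> (\<open>card_twist_solutions_nonconst\<close>).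

  Finally, \<open>\<theta>\<close> is chosen so that the two \<open>K\<^sub>m\<close>-terms are positive, and for large \<open>N\<close> the gain of
  order \<open>1 / N\<close> beats all other terms (\<open>twist_average_exceeds\<close>). The linear part \<open>(a + a') / d\<close>
  is invisible to \<open>K\<^sub>m\<close>, all of whose degrees equal \<open>d\<close>, but it makes every row of \<open>\<Delta>\<close> average
  to zero exactly (\<open>sum_cos_twist_phase_eq_0\<close>); it is here that \<open>m \<ge> 3\<close> enters.
\<close>

section \<open>Densities of step kernels\<close>

text \<open>The minimum puts the endpoint \<open>1\<close> into the last part, so that the parts cover \<open>[0,1]\<close> exactly
  and no null sets have to be discarded.\<close>
definition cell_index :: "nat \<Rightarrow> real \<Rightarrow> nat" where
  "cell_index K x = min (K - 1) (nat \<lfloor>real K * x\<rfloor>)"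

definition step_kernel :: "nat \<Rightarrow> (nat \<Rightarrow> nat \<Rightarrow> real) \<Rightarrow> real \<times> real \<Rightarrow> real" where
  "step_kernel K A z = A (cell_index K (fst z)) (cell_index K (snd z))"

definition cell :: "nat \<Rightarrow> nat \<Rightarrow> real set" where
  "cell K j = {x \<in> {0..1}. cell_index K x = j}"

lemma cell_index_less: "K > 0 \<Longrightarrow> cell_index K x < K"
  by (simp add: cell_index_def)

lemma cell_index_measurable [measurable]: "cell_index K \<in> borel \<rightarrow>\<^sub>M count_space UNIV"
  unfolding cell_index_def by measurable

lemma step_kernel_measurable: "step_kernel K A \<in> borel_measurable borel"
proof -
  have "(\<lambda>z::real \<times> real. A (cell_index K (fst z)) (cell_index K (snd z)))
      \<in> borel_measurable (borel \<Otimes>\<^sub>M borel)"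
    by measurable
  then show ?thesis by (simp add: step_kernel_def[abs_def] borel_prod)
qed

lemma cell_sets [measurable]: "cell K j \<in> sets borel"
  unfolding cell_def by measurable

lemma emeasure_cell:
  assumes "K > 0" "j < K"
  shows "emeasure lborel (cell K j) = ennreal (1 / real K)"
proof -
  let ?I = "{real j / real K..real (Suc j) / real K}"
  have le: "real j / real K \<le> real (Suc j) / real K"
    using assms by (simp add: divide_right_mono)
  \<comment> \<open>The shape of a part depends on whether it is the last one; squeezing it between an open and a
    closed interval of the same length avoids the distinction.\<close>
  have up: "cell K j \<subseteq> ?I"
  proof
    fix x assume x: "x \<in> cell K j"
    then have x01: "0 \<le> x" "x \<le> 1" and idx: "min (K - 1) (nat \<lfloor>real K * x\<rfloor>) = j"
      by (auto simp: cell_def cell_index_def)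
    have Kx: "real K * x \<le> real K" using x01 by (simp add: mult_left_le)
    have nn: "0 \<le> \<lfloor>real K * x\<rfloor>" using x01 by simp
    have "real j \<le> real K * x"
      using idx nn by (smt (verit) min.cobounded2 of_nat_floor of_nat_mono x01 zero_le_mult_iff of_nat_0_le_iff)
    moreover have "real K * x \<le> real (Suc j)"
    proof (cases "j = K - 1")
      case True then show ?thesis using Kx assms by simp
    next
      case False
      then have "nat \<lfloor>real K * x\<rfloor> = j" using idx by (auto simp: min_def split: if_splits)
      then show ?thesis using nn by linarith
    qed
    ultimately show "x \<in> ?I" using assms by (simp add: field_simps)
  qed
  have down: "{real j / real K<..<real (Suc j) / real K} \<subseteq> cell K j"
  proof
    fix x assume "x \<in> {real j / real K<..<real (Suc j) / real K}"
    then have x: "real j < real K * x" "real K * x < real (Suc j)"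
      using assms by (simp_all add: field_simps)
    then have fl: "\<lfloor>real K * x\<rfloor> = int j" by (simp add: floor_eq_iff)
    have "0 < real K * x" using x by simp
    then have "0 \<le> x" using assms by (simp add: zero_less_mult_iff)
    moreover have "real (Suc j) \<le> real K" using assms by simp
    then have "real K * x < real K * 1" using x by linarith
    then have "x \<le> 1" using assms by simp
    ultimately show "x \<in> cell K j" using fl assms by (simp add: cell_def cell_index_def)
  qed
  have len: "real (Suc j) / real K - real j / real K = 1 / real K"
    by (simp add: diff_divide_distrib[symmetric])
  have "emeasure lborel (cell K j) \<le> emeasure lborel ?I"
    by (rule emeasure_mono[OF up]) simp
  moreover have "emeasure lborel {real j / real K<..<real (Suc j) / real K} \<le> emeasure lborel (cell K j)"
    by (rule emeasure_mono[OF down]) simp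
  ultimately show ?thesis
    using le len by (simp add: emeasure_lborel_Icc emeasure_lborel_Ioo antisym)
qed

text \<open>Only the part that contains each coordinate matters, and the boxes formed by the parts all have
  volume \<open>1 / K\<^sup>n\<close> for \<open>n = card V\<close>; so the integral is the average of \<open>G\<close> over all assignments of
  parts.\<close>
lemma integral_cell_index_PiM:
  fixes G :: "('i \<Rightarrow> nat) \<Rightarrow> real"
  assumes "finite V" "K > 0"
  shows "(LINT x:(V \<rightarrow>\<^sub>E {0..1})|(\<Pi>\<^sub>M i\<in>V. lborel). G (\<lambda>v\<in>V. cell_index K (x v))) =
         (\<Sum>g\<in>V \<rightarrow>\<^sub>E {..<K}. G g) / real K ^ card V"
proof -
  interpret product_sigma_finite "\<lambda>_::'i. lborel :: real measure"
    by standard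
  let ?M = "\<Pi>\<^sub>M i\<in>V. (lborel :: real measure)"
  have box: "indicator (V \<rightarrow>\<^sub>E {0..1}) x *\<^sub>R G (\<lambda>v\<in>V. cell_index K (x v)) =
      (\<Sum>g\<in>V \<rightarrow>\<^sub>E {..<K}. G g * indicator (PiE V (\<lambda>v. cell K (g v))) x)" for x :: "'i \<Rightarrow> real"
  proof (cases "x \<in> V \<rightarrow>\<^sub>E {0..1}")
    case True
    let ?g = "\<lambda>v\<in>V. cell_index K (x v)"
    have mem: "x \<in> PiE V (\<lambda>v. cell K (g v)) \<longleftrightarrow> g = ?g" if "g \<in> V \<rightarrow>\<^sub>E {..<K}" for g
      using that True by (auto simp: PiE_iff cell_def fun_eq_iff extensional_def)
    have g: "?g \<in> V \<rightarrow>\<^sub>E {..<K}" using assms(2) by (auto simp: cell_index_less)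
    have "(\<Sum>g\<in>V \<rightarrow>\<^sub>E {..<K}. G g * indicator (PiE V (\<lambda>v. cell K (g v))) x) =
        (\<Sum>g\<in>V \<rightarrow>\<^sub>E {..<K}. if g = ?g then G g else 0)"
      by (intro sum.cong refl) (simp add: indicator_def mem restrict_def)
    also have "\<dots> = G ?g" using g assms(1) by (subst sum.delta) (auto intro: finite_PiE)
    finally show ?thesis using True by simp
  next
    case False
    then have "x \<notin> PiE V (\<lambda>v. cell K (g v))" for g
      by (auto simp: PiE_iff cell_def)
    then show ?thesis using False by simp
  qed
  have em: "emeasure ?M (PiE V (\<lambda>v. cell K (g v))) = ennreal ((1 / real K) ^ card V)"
    if g: "g \<in> V \<rightarrow>\<^sub>E {..<K}" for g
  proof -
    have "emeasure ?M (PiE V (\<lambda>v. cell K (g v))) = (\<Prod>v\<in>V. emeasure lborel (cell K (g v)))"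
      by (rule emeasure_PiM) (use assms in auto)
    also have "\<dots> = (\<Prod>v\<in>V. ennreal (1 / real K))"
      using g assms by (intro prod.cong refl emeasure_cell) (auto simp: PiE_iff)
    finally show ?thesis by (simp add: ennreal_power)
  qed
  have sets: "PiE V (\<lambda>v. cell K (g v)) \<in> sets ?M" for g
    by (rule sets_PiM_I_finite) (use assms in auto)
  have "(LINT x:(V \<rightarrow>\<^sub>E {0..1})|?M. G (\<lambda>v\<in>V. cell_index K (x v))) =
      (LINT x|?M. (\<Sum>g\<in>V \<rightarrow>\<^sub>E {..<K}. G g * indicator (PiE V (\<lambda>v. cell K (g v))) x))"
    unfolding set_lebesgue_integral_def by (simp only: box)
  also have "\<dots> = (\<Sum>g\<in>V \<rightarrow>\<^sub>E {..<K}. LINT x|?M. G g * indicator (PiE V (\<lambda>v. cell K (g v))) x)"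
    using sets em by (intro Bochner_Integration.integral_sum integrable_mult_right
        integrable_real_indicator) auto
  also have "\<dots> = (\<Sum>g\<in>V \<rightarrow>\<^sub>E {..<K}. G g * (1 / real K) ^ card V)"
    using sets em by (intro sum.cong refl) (simp add: measure_def)
  finally show ?thesis
    by (simp add: sum_distrib_right[symmetric] power_one_over divide_inverse power_inverse)
qed

lemma edge_density_step_kernel:
  assumes "K > 0"
  shows "edge_density (step_kernel K A) = (\<Sum>i<K. \<Sum>j<K. A i j) / real K ^ 2"
proof -
  have box: "indicator unit_square z *\<^sub>R step_kernel K A z =
      (\<Sum>(i, j)\<in>{..<K} \<times> {..<K}. A i j * indicator (cell K i \<times> cell K j) z)" for z :: "real \<times> real"
  proof (cases "z \<in> unit_square")
    case True
    let ?p = "(cell_index K (fst z), cell_index K (snd z))"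
    have "(\<Sum>(i, j)\<in>{..<K} \<times> {..<K}. A i j * indicator (cell K i \<times> cell K j) z) =
        (\<Sum>p\<in>{..<K} \<times> {..<K}. if p = ?p then A (fst p) (snd p) else 0)"
      using True by (intro sum.cong refl) (auto simp: indicator_def cell_def)
    also have "\<dots> = A (cell_index K (fst z)) (cell_index K (snd z))"
      using assms by (simp add: sum.delta cell_index_less)
    finally show ?thesis using True by (simp add: step_kernel_def)
  next
    case False
    then have "z \<notin> cell K i \<times> cell K j" for i j
      by (auto simp: cell_def)
    then show ?thesis using False by (simp add: case_prod_beta)
  qed
  have em: "emeasure lborel (cell K i \<times> cell K j) = ennreal ((1 / real K) ^ 2)" if "i < K" "j < K" for i j
  proof -
    have "emeasure lborel (cell K i \<times> cell K j) = emeasure lborel (cell K i) * emeasure lborel (cell K j)"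
      unfolding lborel_prod[symmetric] by (rule lborel.emeasure_pair_measure_Times) auto
    then show ?thesis using that assms by (simp add: emeasure_cell ennreal_mult[symmetric] power2_eq_square)
  qed
  have sets: "cell K i \<times> cell K j \<in> sets lborel" for i j
    by (simp add: borel_Times)
  have "edge_density (step_kernel K A) =
      (LINT z|lborel. (\<Sum>p\<in>{..<K} \<times> {..<K}. A (fst p) (snd p) * indicator (cell K (fst p) \<times> cell K (snd p)) z))"
    unfolding edge_density_def set_lebesgue_integral_def box by (simp add: case_prod_beta)
  also have "\<dots> = (\<Sum>p\<in>{..<K} \<times> {..<K}. LINT z|lborel. A (fst p) (snd p) * indicator (cell K (fst p) \<times> cell K (snd p)) z)"
    using sets em by (intro Bochner_Integration.integral_sum integrable_mult_right
        integrable_real_indicator) auto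
  also have "\<dots> = (\<Sum>p\<in>{..<K} \<times> {..<K}. A (fst p) (snd p) * (1 / real K) ^ 2)"
    using sets em by (intro sum.cong refl) (auto simp: measure_def)
  finally show ?thesis
    by (simp add: sum_distrib_right[symmetric] power_one_over divide_inverse power_inverse
        sum.cartesian_product case_prod_beta)
qed

lemma induced_density_step_kernel:
  assumes "K > 0" "E \<subseteq> nsets {1..m} 2"
  shows "induced_density m E (step_kernel K A) =
    (\<Sum>g\<in>{1..m} \<rightarrow>\<^sub>E {..<K}. \<Prod>e\<in>nsets {1..m} 2.
       if e \<in> E then A (g (Min e)) (g (Max e)) else 1 - A (g (Min e)) (g (Max e))) / real K ^ m"
proof -
  \<comment> \<open>merges the products over edges and non-edges into one over all pairs\<close>
  define B where "B e a = (if e \<in> E then a else 1 - a)" for e :: "nat set" and a :: real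
  have "(\<Prod>e\<in>E. W (x (Min e), x (Max e))) * (\<Prod>f\<in>nsets {1..m} 2 - E. 1 - W (x (Min f), x (Max f))) =
      (\<Prod>e\<in>nsets {1..m} 2. B e (W (x (Min e), x (Max e))))" for W and x :: "nat \<Rightarrow> real"
  proof -
    have "(\<Prod>e\<in>nsets {1..m} 2. B e (W (x (Min e), x (Max e)))) =
        (\<Prod>e\<in>nsets {1..m} 2 - E. B e (W (x (Min e), x (Max e)))) * (\<Prod>e\<in>E. B e (W (x (Min e), x (Max e))))"
      by (rule prod.subset_diff[OF assms(2)]) (simp add: finite_imp_finite_nsets)
    then show ?thesis by (simp add: B_def)
  qed
  then have "induced_density m E (step_kernel K A) =
      (LINT x:({1..m} \<rightarrow>\<^sub>E {0..1})|(\<Pi>\<^sub>M i\<in>{1..m}. lborel).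
        \<Prod>e\<in>nsets {1..m} 2. B e (step_kernel K A (x (Min e), x (Max e))))"
    unfolding induced_density_def by simp
  moreover have "(\<Prod>e\<in>nsets {1..m} 2. B e (step_kernel K A (x (Min e), x (Max e)))) =
      (\<lambda>g. \<Prod>e\<in>nsets {1..m} 2. B e (A (g (Min e)) (g (Max e)))) (\<lambda>v\<in>{1..m}. cell_index K (x v))"
    for x
  proof -
    have "Min e \<in> {1..m}" "Max e \<in> {1..m}" if "e \<in> nsets {1..m} 2" for e
      using that by (auto simp: nsets_2_eq min_def max_def)
    then show ?thesis by (auto simp: step_kernel_def intro!: prod.cong)
  qed
  ultimately have "induced_density m E (step_kernel K A) =
      (LINT x:({1..m} \<rightarrow>\<^sub>E {0..1})|(\<Pi>\<^sub>M i\<in>{1..m}. lborel).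
        (\<lambda>g. \<Prod>e\<in>nsets {1..m} 2. B e (A (g (Min e)) (g (Max e)))) (\<lambda>v\<in>{1..m}. cell_index K (x v)))"
    by presburger
  then show ?thesis
    using assms(1) by (subst (asm) integral_cell_index_PiM) (simp_all add: B_def)
qed

section \<open>Finite sums, roots of unity and sign patterns\<close>
lemma mixed_radix_less:
  fixes a b L N :: nat
  assumes "a < L" "b < N"
  shows "a * N + b < L * N"
proof -
  have "a * N + b < (a + 1) * N" using assms by simp
  also have "\<dots> \<le> L * N" using assms by (intro mult_right_mono) auto
  finally show ?thesis .
qed

text \<open>Reading a part number \<open>k < L * N\<close> as the pair \<open>(k div N, k mod N)\<close> separates the two
  coordinates of all vertices at once.\<close>
lemma sum_PiE_divmod:
  fixes F :: "('i \<Rightarrow> nat) \<Rightarrow> ('i \<Rightarrow> nat) \<Rightarrow> 'a::comm_monoid_add"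
  assumes "N > 0"
  shows "(\<Sum>k\<in>V \<rightarrow>\<^sub>E {..<L * N}. F (\<lambda>v\<in>V. k v div N) (\<lambda>v\<in>V. k v mod N)) =
         (\<Sum>b\<in>V \<rightarrow>\<^sub>E {..<N}. \<Sum>a\<in>V \<rightarrow>\<^sub>E {..<L}. F a b)"
proof -
  have "(\<Sum>(b, a)\<in>(V \<rightarrow>\<^sub>E {..<N}) \<times> (V \<rightarrow>\<^sub>E {..<L}). F a b) =
        (\<Sum>k\<in>V \<rightarrow>\<^sub>E {..<L * N}. F (\<lambda>v\<in>V. k v div N) (\<lambda>v\<in>V. k v mod N))"
    by (rule sum.reindex_bij_witness[where
          i = "\<lambda>k. (\<lambda>v\<in>V. k v mod N, \<lambda>v\<in>V. k v div N)" and
          j = "\<lambda>(b, a). \<lambda>v\<in>V. a v * N + b v"])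
      (use assms in \<open>auto simp: PiE_iff fun_eq_iff extensional_def mixed_radix_less
          less_mult_imp_div_less restrict_def intro!: arg_cong2[where f = F]\<close>)
  then show ?thesis
    by (simp add: sum.cartesian_product)
qed

lemma sum_divmod:
  fixes F :: "nat \<Rightarrow> nat \<Rightarrow> 'a::comm_monoid_add"
  assumes "N > 0"
  shows "(\<Sum>k<L * N. F (k div N) (k mod N)) = (\<Sum>b<N. \<Sum>a<L. F a b)"
proof -
  have "(\<Sum>(b, a)\<in>{..<N} \<times> {..<L}. F a b) = (\<Sum>k<L * N. F (k div N) (k mod N))"
    by (rule sum.reindex_bij_witness[where
        i = "\<lambda>k. (k mod N, k div N)" and j = "\<lambda>(b, a). a * N + b"])
      (use assms in \<open>auto simp: mixed_radix_less less_mult_imp_div_less\<close>)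
  then show ?thesis
    by (simp add: sum.cartesian_product)
qed

lemma sum_cis_multiples:
  assumes "L > 0"
  shows "(\<Sum>a<L. cis (2 * pi * (real a * of_int k) / real L)) =
         (if int L dvd k then of_nat L else 0)"
proof -
  define z where "z = cis (2 * pi * of_int k / real L)"
  have pow: "cis (2 * pi * (real a * of_int k) / real L) = z ^ a" for a
    by (simp add: z_def Complex.DeMoivre field_simps)
  have z1: "z = 1 \<longleftrightarrow> int L dvd k"
  proof
    assume "z = 1"
    then obtain n :: int where "2 * pi * of_int k / real L = of_int n * (2 * pi)"
      by (auto simp: z_def complex_eq_iff cos_one_2pi_int)
    then have "of_int k = real L * of_int n"
      using assms by (simp add: field_simps)
    then have "(of_int k :: real) = of_int (int L * n)" by simp
    then have "k = int L * n" using of_int_eq_iff by blast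
    then show "int L dvd k" by simp
  next
    assume "int L dvd k"
    then obtain n where "k = int L * n" by auto
    then have "2 * pi * of_int k / real L = 2 * pi * of_int n" using assms by simp
    then show "z = 1" by (simp only: z_def cis_multiple_2pi Ints_of_int)
  qed
  have zL: "z ^ L = 1"
    using assms by (simp add: z_def Complex.DeMoivre cis_multiple_2pi)
  show ?thesis
  proof (cases "z = 1")
    case True
    then show ?thesis using z1 by (simp add: pow)
  next
    case False
    then show ?thesis using z1 zL by (simp add: pow sum_gp_strict)
  qed
qed

lemma sum_nsets_2_ordered_pairs:
  fixes s :: "nat set \<Rightarrow> 'a::comm_semiring_0" and h :: "nat \<Rightarrow> nat \<Rightarrow> 'a"
  assumes "finite V"
  shows "(\<Sum>e\<in>nsets V 2. s e * (h (Min e) (Max e) + h (Max e) (Min e))) =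
         (\<Sum>v\<in>V. \<Sum>w\<in>V - {v}. s {v, w} * h v w)"
proof -
  define P where "P = (SIGMA v:V. V - {v})"
  define A where "A = {(v, w). v \<in> V \<and> w \<in> V \<and> v < w}"
  have fin: "finite A" by (rule finite_subset[of _ "V \<times> V"]) (use assms in \<open>auto simp: A_def\<close>)
  have P: "P = A \<union> prod.swap ` A" "A \<inter> prod.swap ` A = {}"
    by (auto simp: P_def A_def image_iff)
  have mm: "Min {v, w} = v" "Max {v, w} = w" if "v < w" for v w :: nat
    using that by (auto simp: min_def max_def)
  have *: "(\<Sum>e\<in>nsets V 2. s e * f (Min e) (Max e)) = (\<Sum>(v, w)\<in>A. s {v, w} * f v w)" for f
    by (rule sum.reindex_bij_witness[where i = "\<lambda>(v, w). {v, w}" and j = "\<lambda>e. (Min e, Max e)"])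
      (auto simp: A_def ordered_nsets_2_eq mm simp del: Min_insert Max_insert)
  have "(\<Sum>v\<in>V. \<Sum>w\<in>V - {v}. s {v, w} * h v w) = (\<Sum>(v, w)\<in>P. s {v, w} * h v w)"
    unfolding P_def using assms by (simp add: sum.Sigma)
  also have "\<dots> = (\<Sum>(v, w)\<in>A. s {v, w} * h v w) + (\<Sum>(v, w)\<in>prod.swap ` A. s {v, w} * h v w)"
    unfolding P(1) using P(2) fin by (intro sum.union_disjoint) auto
  also have "(\<Sum>(v, w)\<in>prod.swap ` A. s {v, w} * h v w) = (\<Sum>(v, w)\<in>A. s {v, w} * h w v)"
    by (subst sum.reindex) (auto simp: insert_commute intro!: sum.cong)
  finally show ?thesis
    by (simp add: distrib_left sum.distrib * *[of "\<lambda>v w. h w v"])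
qed

lemma cis_sum: "cis (\<Sum>e\<in>P. f e) = (\<Prod>e\<in>P. cis (f e))"
  by (induction P rule: infinite_finite_induct) (auto simp: cis_mult[symmetric])

text \<open>A pattern \<open>s\<close> records for each factor whether the constant (\<open>0\<close>) or one of the two
  exponentials of the cosine (\<open>1\<close> or \<open>-1\<close>) is picked; this linearises the product of cosines.\<close>
lemma prod_cos_expand:
  fixes q \<kappa> \<alpha> :: "'e \<Rightarrow> real"
  assumes "finite P"
  shows "complex_of_real (\<Prod>e\<in>P. q e + \<kappa> e * cos (\<alpha> e)) =
         (\<Sum>s\<in>P \<rightarrow>\<^sub>E {-1, 0, 1 :: int}.
            of_real (\<Prod>e\<in>P. if s e = 0 then q e else \<kappa> e / 2) * cis (\<Sum>e\<in>P. of_int (s e) * \<alpha> e))"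
proof -
  define g :: "'e \<Rightarrow> int \<Rightarrow> complex" where
    "g e t = of_real (if t = 0 then q e else \<kappa> e / 2) * cis (of_int t * \<alpha> e)" for e t
  have "complex_of_real (q e + \<kappa> e * cos (\<alpha> e)) = (\<Sum>t\<in>{-1, 0, 1}. g e t)" for e
    by (auto simp: g_def complex_eq_iff)
  then have "complex_of_real (\<Prod>e\<in>P. q e + \<kappa> e * cos (\<alpha> e)) = (\<Prod>e\<in>P. \<Sum>t\<in>{-1, 0, 1}. g e t)"
    by simp
  also have "\<dots> = (\<Sum>s\<in>P \<rightarrow>\<^sub>E {-1, 0, 1}. \<Prod>e\<in>P. g e (s e))"
    using assms by (intro prod_sum_PiE) auto
  also have "\<dots> = (\<Sum>s\<in>P \<rightarrow>\<^sub>E {-1, 0, 1}.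
      of_real (\<Prod>e\<in>P. if s e = 0 then q e else \<kappa> e / 2) * cis (\<Sum>e\<in>P. of_int (s e) * \<alpha> e))"
    unfolding g_def prod.distrib of_real_prod cis_sum by simp
  finally show ?thesis .
qed

section \<open>The quadratic phase and its linear systems\<close>

text \<open>The coefficient of \<open>a\<close> in the phase, multiplied by the common denominator \<open>d * N\<close>:
  \<open>twist d N b b' / (d * N) = (b + d * b') / N + 1 / d\<close>. The factor \<open>d\<close> before \<open>b'\<close>
  is what makes the system of \<open>K\<^sub>m\<close> have rank one: a vertex of degree \<open>d\<close> collects
  \<open>d * b\<close> from itself and \<open>d * b'\<close> from each of its neighbours.\<close>
definition twist :: "nat \<Rightarrow> nat \<Rightarrow> nat \<Rightarrow> nat \<Rightarrow> int" where
  "twist d N b b' = int d * (int b + int d * int b') + int N"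

text \<open>The assignments \<open>b\<close> for which the coefficient of every \<open>a\<close>-coordinate in the total phase of
  the pattern \<open>s\<close> is an integer multiple of \<open>2 * pi\<close>.\<close>
definition twist_solutions :: "nat \<Rightarrow> nat \<Rightarrow> nat set \<Rightarrow> (nat set \<Rightarrow> int) \<Rightarrow> (nat \<Rightarrow> nat) set" where
  "twist_solutions d N V s = {b \<in> V \<rightarrow>\<^sub>E {..<N}.
     \<forall>v\<in>V. int (d * N) dvd (\<Sum>w\<in>V - {v}. s {v, w} * twist d N (b v) (b w))}"

definition twist_phase :: "nat \<Rightarrow> nat \<Rightarrow> nat \<Rightarrow> nat \<Rightarrow> real" where
  "twist_phase d N k l = 2 * pi *
     (real (k div N) * of_int (twist d N (k mod N) (l mod N)) +
      real (l div N) * of_int (twist d N (l mod N) (k mod N))) / real (d * N)"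

lemma twist_phase_commute: "twist_phase d N k l = twist_phase d N l k"
  by (simp add: twist_phase_def add.commute)

lemma finite_twist_solutions: "finite V \<Longrightarrow> finite (twist_solutions d N V s)"
  unfolding twist_solutions_def by (rule finite_Collect_conjI) (simp add: finite_PiE)

text \<open>For fixed \<open>b\<close> the total phase is linear in the \<open>a\<close>-coordinates, so the sum over them
  factors into full character sums, one for each vertex. These vanish unless \<open>b\<close> solves the system,
  and the mean of the exponential becomes, up to the rotation by \<open>\<theta>\<close>, the proportion of solutions.\<close>
lemma sum_cis_twist_phase:
  assumes "finite V" "d > 0" "N > 0"
  shows "(\<Sum>k\<in>V \<rightarrow>\<^sub>E {..<d * N * N}.
            cis (\<Sum>e\<in>nsets V 2. of_int (s e) * (twist_phase d N (k (Min e)) (k (Max e)) + \<theta>))) =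
         cis (\<theta> * of_int (\<Sum>e\<in>nsets V 2. s e)) *
           of_nat ((d * N) ^ card V * card (twist_solutions d N V s))"
proof -
  define row where "row b v = (\<Sum>w\<in>V - {v}. s {v, w} * twist d N (b v) (b w))" for b :: "nat \<Rightarrow> nat" and v
  define F where "F a b = (\<Prod>v\<in>V. cis (2 * pi * (real (a v) * of_int (row b v)) / real (d * N)))"
    for a b :: "nat \<Rightarrow> nat"
  have phase: "(\<Sum>e\<in>nsets V 2. of_int (s e) * twist_phase d N (k (Min e)) (k (Max e))) =
      (\<Sum>v\<in>V. 2 * pi * (real (k v div N) * of_int (row (\<lambda>v\<in>V. k v mod N) v)) / real (d * N))" for k
  proof -
    have "(\<Sum>e\<in>nsets V 2. of_int (s e) * twist_phase d N (k (Min e)) (k (Max e))) =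
        (\<Sum>v\<in>V. \<Sum>w\<in>V - {v}. of_int (s {v, w}) *
          (2 * pi * real (k v div N) * of_int (twist d N (k v mod N) (k w mod N)) / real (d * N)))"
      by (subst sum_nsets_2_ordered_pairs[OF assms(1), symmetric])
        (simp add: twist_phase_def add_divide_distrib distrib_left mult.assoc)
    then show ?thesis
      by (simp add: row_def sum_distrib_left sum_divide_distrib mult_ac)
  qed
  have "cis (\<Sum>e\<in>nsets V 2. of_int (s e) * (twist_phase d N (k (Min e)) (k (Max e)) + \<theta>)) =
      cis (\<theta> * of_int (\<Sum>e\<in>nsets V 2. s e)) * F (\<lambda>v\<in>V. k v div N) (\<lambda>v\<in>V. k v mod N)" for k
  proof -
    have "(\<Sum>e\<in>nsets V 2. of_int (s e) * (twist_phase d N (k (Min e)) (k (Max e)) + \<theta>)) =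
        \<theta> * of_int (\<Sum>e\<in>nsets V 2. s e) +
        (\<Sum>v\<in>V. 2 * pi * (real (k v div N) * of_int (row (\<lambda>v\<in>V. k v mod N) v)) / real (d * N))"
      by (simp add: distrib_left sum.distrib phase sum_distrib_left mult.commute)
    then show ?thesis
      by (simp add: F_def cis_sum cis_mult[symmetric])
  qed
  then have "(\<Sum>k\<in>V \<rightarrow>\<^sub>E {..<d * N * N}.
        cis (\<Sum>e\<in>nsets V 2. of_int (s e) * (twist_phase d N (k (Min e)) (k (Max e)) + \<theta>))) =
      cis (\<theta> * of_int (\<Sum>e\<in>nsets V 2. s e)) *
        (\<Sum>k\<in>V \<rightarrow>\<^sub>E {..<d * N * N}. F (\<lambda>v\<in>V. k v div N) (\<lambda>v\<in>V. k v mod N))"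
    by (simp add: sum_distrib_left)
  also have "(\<Sum>k\<in>V \<rightarrow>\<^sub>E {..<d * N * N}. F (\<lambda>v\<in>V. k v div N) (\<lambda>v\<in>V. k v mod N)) =
      (\<Sum>b\<in>V \<rightarrow>\<^sub>E {..<N}. \<Sum>a\<in>V \<rightarrow>\<^sub>E {..<d * N}. F a b)"
    using assms(3) by (rule sum_PiE_divmod)
  also have "\<dots> = (\<Sum>b\<in>V \<rightarrow>\<^sub>E {..<N}. if b \<in> twist_solutions d N V s then of_nat ((d * N) ^ card V) else 0)"
  proof (intro sum.cong refl)
    fix b assume b: "b \<in> V \<rightarrow>\<^sub>E {..<N}"
    have "(\<Sum>a\<in>V \<rightarrow>\<^sub>E {..<d * N}. F a b) =
        (\<Prod>v\<in>V. \<Sum>a<d * N. cis (2 * pi * (real a * of_int (row b v)) / real (d * N)))"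
      unfolding F_def using assms(1) by (intro prod_sum_PiE[symmetric]) auto
    also have "\<dots> = (\<Prod>v\<in>V. if int (d * N) dvd row b v then of_nat (d * N) else 0)"
      using assms by (intro prod.cong refl sum_cis_multiples) simp
    also have "\<dots> = (if b \<in> twist_solutions d N V s then of_nat ((d * N) ^ card V) else 0)"
      using b assms by (auto simp: twist_solutions_def row_def simp del: of_nat_mult)
    finally show "(\<Sum>a\<in>V \<rightarrow>\<^sub>E {..<d * N}. F a b) =
        (if b \<in> twist_solutions d N V s then of_nat ((d * N) ^ card V) else 0)" .
  qed
  also have "\<dots> = of_nat ((d * N) ^ card V * card (twist_solutions d N V s))"
  proof -
    have "(V \<rightarrow>\<^sub>E {..<N}) \<inter> twist_solutions d N V s = twist_solutions d N V s"
      by (auto simp: twist_solutions_def)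
    then show ?thesis using assms(1) by (simp add: sum.If_cases finite_PiE Int_def)
  qed
  finally show ?thesis .
qed

lemma card_twist_solutions_zero:
  assumes "finite V" "\<And>e. e \<in> nsets V 2 \<Longrightarrow> s e = 0"
  shows "card (twist_solutions d N V s) = N ^ card V"
proof -
  have "s {v, w} = 0" if "v \<in> V" "w \<in> V - {v}" for v w
    using that assms(2) by (auto simp: nsets_2_eq)
  then have "twist_solutions d N V s = V \<rightarrow>\<^sub>E {..<N}"
    by (auto simp: twist_solutions_def)
  then show ?thesis using assms(1) by (simp add: card_PiE)
qed

text \<open>For the complete graph all equations of the system follow from the single one
  \<open>\<Sum> b \<equiv> 0 (mod N)\<close>, since the terms \<open>d * N\<close> contributed by the linear part of the phase drop
  out. So all but one coordinate can be prescribed freely, and the remaining one can be solved for.\<close>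
lemma card_twist_solutions_const_ge:
  assumes "finite V" "V \<noteq> {}" "d + 1 = card V" "N > 0"
    and s: "\<And>e. e \<in> nsets V 2 \<Longrightarrow> s e = \<sigma>"
  shows "N ^ (card V - 1) \<le> card (twist_solutions d N V s)"
proof -
  obtain v0 where v0: "v0 \<in> V" using assms(2) by auto
  \<comment> \<open>the extension to \<open>v0\<close> that makes the sum of all coordinates divisible by \<open>N\<close>\<close>
  define ext where "ext f = f(v0 := nat ((- (\<Sum>v\<in>V - {v0}. int (f v))) mod int N))" for f :: "nat \<Rightarrow> nat"
  have "ext f \<in> twist_solutions d N V s" if f: "f \<in> V - {v0} \<rightarrow>\<^sub>E {..<N}" for f
  proof -
    let ?b = "ext f"
    have PiE: "?b \<in> V \<rightarrow>\<^sub>E {..<N}"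
      using f v0 assms(4) by (auto simp: ext_def PiE_iff extensional_def nat_less_iff)
    have "(\<Sum>v\<in>V. int (?b v)) = int (?b v0) + (\<Sum>v\<in>V - {v0}. int (f v))"
      using v0 assms(1) by (subst sum.remove[of _ v0]) (auto simp: ext_def intro!: sum.cong)
    also have "int (?b v0) = (- (\<Sum>v\<in>V - {v0}. int (f v))) mod int N"
      using assms(4) by (simp add: ext_def)
    finally have "(\<Sum>v\<in>V. int (?b v)) mod int N = 0"
      by (simp add: mod_add_left_eq)
    then have dvd: "int N dvd (\<Sum>v\<in>V. int (?b v))" by auto
    have row: "(\<Sum>w\<in>V - {v}. s {v, w} * twist d N (?b v) (?b w)) =
        \<sigma> * (int d * int d * (\<Sum>w\<in>V. int (?b w)) + int d * int N)" if v: "v \<in> V" for v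
    proof -
      have cd: "card (V - {v}) = d" using assms v by simp
      have "s {v, w} = \<sigma>" if "w \<in> V - {v}" for w
        using that v s by (auto simp: nsets_2_eq)
      then have "(\<Sum>w\<in>V - {v}. s {v, w} * twist d N (?b v) (?b w)) =
          (\<Sum>w\<in>V - {v}. \<sigma> * (int d * int (?b v) + int N + int d * int d * int (?b w)))"
        by (intro sum.cong refl) (simp add: twist_def algebra_simps)
      also have "\<dots> = \<sigma> * (int d * (int d * int (?b v) + int N) + int d * int d * (\<Sum>w\<in>V - {v}. int (?b w)))"
        using cd by (simp add: sum_distrib_left[symmetric] sum.distrib)
      also have "(\<Sum>w\<in>V - {v}. int (?b w)) = (\<Sum>w\<in>V. int (?b w)) - int (?b v)"
        using v assms(1) by (simp add: sum.remove[of _ v])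
      finally show ?thesis by (simp add: algebra_simps)
    qed
    have "int (d * N) dvd \<sigma> * (int d * int d * (\<Sum>w\<in>V. int (?b w)) + int d * int N)"
    proof -
      have "int (d * N) dvd int d * (int d * (\<Sum>w\<in>V. int (?b w)))"
        using dvd by (simp add: mult_dvd_mono)
      then show ?thesis by (intro dvd_mult) (simp add: dvd_add mult.assoc)
    qed
    with PiE row show ?thesis by (simp add: twist_solutions_def)
  qed
  moreover have "inj_on ext (V - {v0} \<rightarrow>\<^sub>E {..<N})"
  proof (rule inj_onI)
    fix f g assume fg: "f \<in> V - {v0} \<rightarrow>\<^sub>E {..<N}" "g \<in> V - {v0} \<rightarrow>\<^sub>E {..<N}" "ext f = ext g"
    show "f = g"
    proof (rule PiE_ext[OF fg(1,2)])
      fix v assume "v \<in> V - {v0}"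
      then show "f v = g v" using fun_cong[OF fg(3), of v] by (simp add: ext_def)
    qed
  qed
  ultimately have "card (V - {v0} \<rightarrow>\<^sub>E {..<N}) \<le> card (twist_solutions d N V s)"
    using finite_twist_solutions[OF assms(1)] by (intro card_inj_on_le[of ext]) auto
  then show ?thesis using assms(1) v0 by (simp add: card_PiE)
qed

text \<open>Two solutions that agree outside \<open>v\<close> and \<open>w\<close> differ by a solution of the homogeneous system
  with the two-by-two matrix of diagonal \<open>deg v\<close>, \<open>deg w\<close> and off-diagonal entries
  \<open>d * s {v, w}\<close>. If its determinant is invertible modulo \<open>N\<close>, a solution is thus determined by its
  other coordinates.\<close>
lemma card_twist_solutions_minor:
  assumes "finite V" "d > 0" "prime N" and vw: "v \<in> V" "w \<in> V" "v \<noteq> w"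
    and D: "\<not> int N dvd (\<Sum>u\<in>V - {v}. s {v, u}) * (\<Sum>u\<in>V - {w}. s {w, u}) - (int d * s {v, w})\<^sup>2"
  shows "card (twist_solutions d N V s) \<le> N ^ (card V - 2)"
proof -
  define deg where "deg v = (\<Sum>u\<in>V - {v}. s {v, u})" for v
  let ?S = "twist_solutions d N V s"
  let ?R = "\<lambda>b :: nat \<Rightarrow> nat. restrict b (V - {v, w})"
  have step: "int N dvd deg x * (int (b x) - int (b' x)) + int d * s {x, y} * (int (b y) - int (b' y))"
    if b: "b \<in> ?S" "b' \<in> ?S" and eq: "\<And>u. u \<in> V - {x, y} \<Longrightarrow> b u = b' u"
      and xy: "x \<in> V" "y \<in> V" "x \<noteq> y" for b b' x y
  proof -
    have "(\<Sum>u\<in>V - {x}. s {x, u} * twist d N (b x) (b u)) - (\<Sum>u\<in>V - {x}. s {x, u} * twist d N (b' x) (b' u)) =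
        (\<Sum>u\<in>V - {x}. s {x, u} * (int d * (int (b x) - int (b' x))) +
           (if u = y then s {x, y} * (int d * int d * (int (b y) - int (b' y))) else 0))"
      unfolding sum_subtractf[symmetric] using eq
      by (intro sum.cong refl) (auto simp: twist_def algebra_simps)
    also have "\<dots> = deg x * (int d * (int (b x) - int (b' x))) +
        s {x, y} * (int d * int d * (int (b y) - int (b' y)))"
      unfolding sum.distrib deg_def sum_distrib_right using xy assms(1) by simp
    also have "\<dots> = int d * (deg x * (int (b x) - int (b' x)) + int d * s {x, y} * (int (b y) - int (b' y)))"
      by (simp add: algebra_simps)
    finally have *: "\<dots> = (\<Sum>u\<in>V - {x}. s {x, u} * twist d N (b x) (b u)) -
        (\<Sum>u\<in>V - {x}. s {x, u} * twist d N (b' x) (b' u))" ..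
    have "int d * int N dvd int d * (deg x * (int (b x) - int (b' x)) + int d * s {x, y} * (int (b y) - int (b' y)))"
      unfolding * using b xy by (intro dvd_diff) (auto simp: twist_solutions_def)
    then show ?thesis using assms(2) by simp
  qed
  have zero: "x = x'" if "int N dvd int x - int x'" "x < N" "x' < N" for x x'
    using that zdvd_imp_le[of "int N" "int x - int x'"] zdvd_imp_le[of "int N" "int x' - int x"]
    by (cases x x' rule: linorder_cases) (auto simp: dvd_diff_commute)
  have "inj_on ?R ?S"
  proof (rule inj_onI)
    fix b b' assume b: "b \<in> ?S" "b' \<in> ?S" and r: "?R b = ?R b'"
    have eq: "b u = b' u" if "u \<in> V - {v, w}" for u
      using fun_cong[OF r, of u] that by simp
    have lt: "b u < N" "b' u < N" if "u \<in> V" for u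
      using b that by (auto simp: twist_solutions_def)
    define x y where "x = int (b v) - int (b' v)" and "y = int (b w) - int (b' w)"
    have 1: "int N dvd deg v * x + int d * s {v, w} * y"
      unfolding x_def y_def using step[OF b, of v w] eq vw by auto
    have 2: "int N dvd deg w * y + int d * s {v, w} * x"
      unfolding x_def y_def using step[OF b, of w v] eq vw by (auto simp: insert_commute)
    define D0 where "D0 = deg v * deg w - (int d * s {v, w})\<^sup>2"
    have D0: "\<not> int N dvd D0" using D by (simp add: D0_def deg_def)
    \<comment> \<open>Cramer's rule for the congruences \<open>1\<close> and \<open>2\<close>\<close>
    have "D0 * x = deg w * (deg v * x + int d * s {v, w} * y) - int d * s {v, w} * (deg w * y + int d * s {v, w} * x)"
      by (simp add: D0_def algebra_simps power2_eq_square)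
    then have "int N dvd D0 * x" using 1 2 by (simp only: dvd_diff dvd_mult)
    then have "int N dvd x" using D0 assms(3) by (simp add: prime_dvd_mult_iff)
    then have bv: "b v = b' v" unfolding x_def using lt vw zero by blast
    have "D0 * y = deg v * (deg w * y + int d * s {v, w} * x) - int d * s {v, w} * (deg v * x + int d * s {v, w} * y)"
      by (simp add: D0_def algebra_simps power2_eq_square)
    then have "int N dvd D0 * y" using 1 2 by (simp only: dvd_diff dvd_mult)
    then have "int N dvd y" using D0 assms(3) by (simp add: prime_dvd_mult_iff)
    then have bw: "b w = b' w" unfolding y_def using lt vw zero by blast
    have "b \<in> V \<rightarrow>\<^sub>E {..<N}" "b' \<in> V \<rightarrow>\<^sub>E {..<N}" using b by (auto simp: twist_solutions_def)
    then show "b = b'"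
      by (rule PiE_ext) (use eq bv bw in blast)
  qed
  moreover have "?R ` ?S \<subseteq> V - {v, w} \<rightarrow>\<^sub>E {..<N}"
  proof -
    have "?S \<subseteq> V \<rightarrow>\<^sub>E {..<N}" by (auto simp: twist_solutions_def)
    then show ?thesis unfolding image_subset_iff restrict_PiE_iff by (blast dest: PiE_mem)
  qed
  ultimately have "card ?S \<le> card (V - {v, w} \<rightarrow>\<^sub>E {..<N})"
    by (rule card_inj_on_le) (use assms(1) in \<open>simp add: finite_PiE\<close>)
  moreover have "card (V - {v, w}) = card V - 2"
    using vw assms(1) by (simp add: card_Diff_subset)
  ultimately show ?thesis using assms(1) by (simp add: card_PiE)
qed

lemma abs_signed_degree_le:
  fixes s :: "nat set \<Rightarrow> int"
  assumes "finite V" "d + 1 = card V" and s: "s \<in> nsets V 2 \<rightarrow>\<^sub>E {-1, 0, 1}" and "v \<in> V"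
  shows "\<bar>\<Sum>u\<in>V - {v}. s {v, u}\<bar> \<le> int d"
proof -
  have val: "s {v, u} \<in> {-1, 0, 1}" if "u \<in> V - {v}" for u
    using s that assms(4) by (auto simp: PiE_iff doubleton_in_nsets_2)
  have "\<bar>\<Sum>u\<in>V - {v}. s {v, u}\<bar> \<le> (\<Sum>u\<in>V - {v}. \<bar>s {v, u}\<bar>)"
    by (rule sum_abs)
  also have "\<dots> \<le> (\<Sum>u\<in>V - {v}. 1)"
    using val by (intro sum_mono) fastforce
  finally show ?thesis using assms(1,2,4) by simp
qed

text \<open>Signed degrees lie between \<open>-d\<close> and \<open>d\<close>. If the product of the degrees at the ends of an edge
  is \<open>d\<^sup>2\<close>, both degrees are \<open>\<sigma> * d\<close> for the same sign \<open>\<sigma>\<close>, and then all pairs at either end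
  carry the value \<open>\<sigma>\<close>. If this held for every edge of a nonzero pattern, it would spread from one
  edge to all vertices, so that the pattern would be constant.\<close>
lemma exists_nonsingular_pair:
  fixes s :: "nat set \<Rightarrow> int"
  assumes "finite V" "d + 1 = card V"
    and s: "s \<in> nsets V 2 \<rightarrow>\<^sub>E {-1, 0, 1}"
    and nonconst: "\<And>\<sigma>. \<sigma> \<in> {-1, 0, 1} \<Longrightarrow> s \<noteq> (\<lambda>e\<in>nsets V 2. \<sigma>)"
  shows "\<exists>v\<in>V. \<exists>w\<in>V - {v}. s {v, w} \<noteq> 0 \<and>
    (\<Sum>u\<in>V - {v}. s {v, u}) * (\<Sum>u\<in>V - {w}. s {w, u}) \<noteq> (int d)\<^sup>2"
proof (rule ccontr)
  define deg where "deg v = (\<Sum>u\<in>V - {v}. s {v, u})" for v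
  assume "\<not> ?thesis"
  then have all: "deg v * deg w = (int d)\<^sup>2" if "v \<in> V" "w \<in> V" "v \<noteq> w" "s {v, w} \<noteq> 0" for v w
    using that unfolding deg_def by blast
  have val: "s {v, w} \<in> {-1, 0, 1}" if "v \<in> V" "w \<in> V" "v \<noteq> w" for v w
    using s that by (auto simp: PiE_iff doubleton_in_nsets_2)
  have cd: "card (V - {v}) = d" if "v \<in> V" for v
    using that assms(1,2) by simp
  have bound: "\<bar>deg v\<bar> \<le> int d" if "v \<in> V" for v
    unfolding deg_def by (rule abs_signed_degree_le[OF assms(1,2) s that])
  have extremal: "s {v, w} = \<sigma>"
    if vw: "v \<in> V" "w \<in> V" "v \<noteq> w" and \<sigma>: "\<sigma> \<in> {-1, 1}" and deg: "deg v = \<sigma> * int d" for v w \<sigma>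
  proof -
    have nonneg: "0 \<le> 1 - \<sigma> * s {v, u}" if "u \<in> V - {v}" for u
      using val[of v u] \<sigma> vw that by auto
    \<comment> \<open>The defects from the value \<open>\<sigma>\<close> are nonnegative and add up to zero.\<close>
    have "(\<Sum>u\<in>V - {v}. 1 - \<sigma> * s {v, u}) = int d - \<sigma> * deg v"
      using cd vw by (simp add: sum_subtractf sum_distrib_left deg_def)
    also have "\<dots> = 0" using \<sigma> deg by auto
    finally have "1 - \<sigma> * s {v, w} = 0"
      using nonneg vw assms(1) by (subst (asm) sum_nonneg_eq_0_iff) auto
    then show ?thesis using \<sigma> by auto
  qed
  have sign: "\<exists>\<sigma>\<in>{-1, 1}. deg v = \<sigma> * int d \<and> deg w = \<sigma> * int d"
    if "v \<in> V" "w \<in> V" "deg v * deg w = (int d)\<^sup>2" for v w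
  proof -
    have "\<bar>deg v\<bar> * \<bar>deg w\<bar> = int d * int d"
      using that(3) by (simp add: abs_mult[symmetric] power2_eq_square)
    moreover have "\<bar>deg v\<bar> * \<bar>deg w\<bar> \<le> \<bar>deg v\<bar> * int d" "\<bar>deg v\<bar> * int d \<le> int d * int d"
      using bound[OF that(1)] bound[OF that(2)] by (auto intro: mult_left_mono mult_right_mono)
    ultimately have "\<bar>deg v\<bar> * int d = int d * int d" "\<bar>deg v\<bar> * \<bar>deg w\<bar> = \<bar>deg v\<bar> * int d"
      by linarith+
    then have abs: "\<bar>deg v\<bar> = int d" "\<bar>deg w\<bar> = int d"
      using bound[OF that(1)] bound[OF that(2)] by auto
    have "deg v = int d \<or> deg v = - int d" "deg w = int d \<or> deg w = - int d"
      using abs by linarith+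
    then show ?thesis using that(3) by (auto simp: power2_eq_square)
  qed
  obtain e where e: "e \<in> nsets V 2" "s e \<noteq> 0"
  proof -
    have "s = (\<lambda>e\<in>nsets V 2. 0)" if "\<And>e. e \<in> nsets V 2 \<Longrightarrow> s e = 0"
      using that by (intro PiE_ext[OF s]) auto
    then show thesis using that nonconst[of 0] by blast
  qed
  then obtain v0 w0 where v0: "v0 \<in> V" "w0 \<in> V" "v0 \<noteq> w0" "s {v0, w0} \<noteq> 0"
    by (auto simp: nsets_2_eq)
  then obtain \<sigma> where \<sigma>: "\<sigma> \<in> {-1, 1}" "deg v0 = \<sigma> * int d"
    using sign[OF _ _ all] by blast
  have d: "d > 0" using card_mono[of V "{v0, w0}"] v0 assms(1,2) by simp
  have degs: "deg x = \<sigma> * int d" if x: "x \<in> V" for x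
  proof (cases "x = v0")
    case False
    then have "s {v0, x} \<noteq> 0" using extremal[OF v0(1) x _ \<sigma>] \<sigma>(1) by auto
    then obtain \<tau> where "\<tau> \<in> {-1, 1}" "deg v0 = \<tau> * int d" "deg x = \<tau> * int d"
      using sign[OF v0(1) x all] v0(1) x False by blast
    then show ?thesis using \<sigma> d by auto
  qed (use \<sigma> in simp)
  have "s = (\<lambda>e\<in>nsets V 2. \<sigma>)"
  proof (rule PiE_ext[OF s])
    show "(\<lambda>e\<in>nsets V 2. \<sigma>) \<in> nsets V 2 \<rightarrow>\<^sub>E {-1, 0, 1}" using \<sigma> by auto
    fix e assume "e \<in> nsets V 2"
    then show "s e = (\<lambda>e\<in>nsets V 2. \<sigma>) e"
      using extremal \<sigma>(1) degs by (auto simp: nsets_2_eq)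
  qed
  then show False using nonconst \<sigma>(1) by blast
qed

text \<open>The bound \<open>2 * d\<^sup>2 < N\<close> turns a minor that is nonzero over the integers into one that is
  nonzero modulo \<open>N\<close>.\<close>
lemma card_twist_solutions_nonconst:
  assumes "finite V" "d + 1 = card V" "prime N" "2 * d\<^sup>2 < N"
    and s: "s \<in> nsets V 2 \<rightarrow>\<^sub>E {-1, 0, 1}"
    and nonconst: "\<And>\<sigma>. \<sigma> \<in> {-1, 0, 1} \<Longrightarrow> s \<noteq> (\<lambda>e\<in>nsets V 2. \<sigma>)"
  shows "card (twist_solutions d N V s) \<le> N ^ (card V - 2)"
proof -
  define deg where "deg v = (\<Sum>u\<in>V - {v}. s {v, u})" for v
  obtain v w where vw: "v \<in> V" "w \<in> V" "v \<noteq> w" "s {v, w} \<noteq> 0" and ne: "deg v * deg w \<noteq> (int d)\<^sup>2"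
    using exists_nonsingular_pair[OF assms(1,2) s nonconst] unfolding deg_def by blast
  have bound: "\<bar>deg x\<bar> \<le> int d" if "x \<in> V" for x
    unfolding deg_def by (rule abs_signed_degree_le[OF assms(1,2) s that])
  have s2: "(int d * s {v, w})\<^sup>2 = (int d)\<^sup>2"
  proof -
    have "s {v, w} \<in> {-1, 0, 1}" using s vw by (auto simp: PiE_iff doubleton_in_nsets_2)
    then show ?thesis using vw by (auto simp: power_mult_distrib)
  qed
  have "\<bar>deg v * deg w\<bar> \<le> int d * int d"
    unfolding abs_mult using bound vw by (intro mult_mono) auto
  then have "\<bar>deg v * deg w - (int d)\<^sup>2\<bar> \<le> 2 * (int d)\<^sup>2"
    by (simp add: power2_eq_square abs_le_iff)
  also have "\<dots> = int (2 * d\<^sup>2)" by simp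
  also have "\<dots> < int N" using assms(4) by (simp only: of_nat_less_iff)
  finally have "\<not> int N dvd deg v * deg w - (int d)\<^sup>2"
    using ne dvd_imp_le_int[of "deg v * deg w - (int d)\<^sup>2" "int N"] by auto
  moreover have "d > 0"
    using card_mono[of V "{v, w}"] vw assms(1,2) by simp
  ultimately show ?thesis
    using vw s2 assms(1,3) by (intro card_twist_solutions_minor[of V d N v w]) (auto simp: deg_def)
qed

section \<open>The gain over the constant graphon\<close>

text \<open>A single edge has signed degrees \<open>1\<close>, so the summand \<open>N\<close> of the twist survives, and
  it is not divisible by \<open>d\<close>. Hence no \<open>b\<close> solves the equation of a single vertex, and already
  the rows of the kernel sum to zero.\<close>
lemma sum_cos_twist_phase_eq_0:
  assumes "d > 0" "N > 0" "\<not> d dvd N"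
  shows "(\<Sum>k<d * N * N. cos (twist_phase d N k l + \<theta>)) = 0"
proof -
  define t where "t b = twist d N b (l mod N)" for b
  define r where "r b = 2 * pi * (real (l div N) * of_int (twist d N (l mod N) b)) / real (d * N) + \<theta>" for b
  have ndvd: "\<not> int (d * N) dvd t b" for b
  proof
    assume "int (d * N) dvd t b"
    then have "int d dvd t b" by (auto intro: dvd_mult_left)
    then have "int d dvd int N" by (simp add: t_def twist_def dvd_add_right_iff)
    then show False using assms(3) by simp
  qed
  have "(\<Sum>k<d * N * N. cos (twist_phase d N k l + \<theta>)) =
      (\<Sum>k<d * N * N. (\<lambda>a b. cos (2 * pi * (real a * of_int (t b)) / real (d * N) + r b)) (k div N) (k mod N))"
    by (simp add: twist_phase_def t_def r_def add_divide_distrib distrib_left add.assoc)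
  also have "\<dots> = (\<Sum>b<N. \<Sum>a<d * N. cos (2 * pi * (real a * of_int (t b)) / real (d * N) + r b))"
    by (rule sum_divmod[OF assms(2)])
  also have "\<dots> = (\<Sum>b<N. Re (cis (r b) * (\<Sum>a<d * N. cis (2 * pi * (real a * of_int (t b)) / real (d * N)))))"
    unfolding sum_distrib_left cis_mult by (simp add: Re_sum add.commute)
  also have "\<dots> = 0"
    using ndvd assms by (subst sum_cis_multiples) (simp_all del: of_nat_mult)
  finally show ?thesis .
qed

lemma exists_phase_aligning:
  fixes c :: real
  assumes "M > 0"
  obtains \<theta> where "c * cos (\<theta> * real M) = \<bar>c\<bar>"
proof (cases "c \<ge> 0")
  case True
  then show ?thesis using that[of 0] by simp
next
  case False
  then show ?thesis using that[of "pi / real M"] assms by simp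
qed

text \<open>The terms of the patterns \<open>0\<close> and \<open>1\<close> are at least \<open>\<Prod> q\<close> and
  \<open>\<eta> / N\<close>, the pattern \<open>-1\<close> gives a nonnegative term by symmetry, and the others lose at most
  \<open>C / N\<^sup>2\<close> in total. Neither \<open>\<eta>\<close> nor \<open>C\<close> depends on \<open>N\<close>, so it is enough that \<open>N > C / \<eta>\<close>.\<close>
lemma twist_average_exceeds:
  fixes q \<kappa> :: "nat set \<Rightarrow> real"
  assumes "finite V" "d + 1 = card V" "d > 0"
    and \<kappa>: "\<And>e. e \<in> nsets V 2 \<Longrightarrow> \<kappa> e \<noteq> 0"
  shows "\<exists>N \<theta>. prime N \<and> N > d \<and>
    (\<Prod>e\<in>nsets V 2. q e) <
    (\<Sum>k\<in>V \<rightarrow>\<^sub>E {..<d * N * N}.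
      \<Prod>e\<in>nsets V 2. q e + \<kappa> e * cos (twist_phase d N (k (Min e)) (k (Max e)) + \<theta>)) /
      real (d * N * N) ^ card V"
proof -
  define P where "P = nsets V 2"
  define S where "S = P \<rightarrow>\<^sub>E {-1, 0, 1 :: int}"
  define W where "W s = (\<Prod>e\<in>P. if s e = 0 then q e else \<kappa> e / 2)" for s :: "nat set \<Rightarrow> int"
  define C where "C = (\<Sum>s\<in>S. \<bar>W s\<bar>)"
  define \<eta> where "\<eta> = \<bar>\<Prod>e\<in>P. \<kappa> e / 2\<bar>"
  have finP: "finite P" using assms(1) by (simp add: P_def finite_imp_finite_nsets)
  have finS: "finite S" using finP by (simp add: S_def finite_PiE)
  have "V \<noteq> {}" using assms(2) by auto
  have cardP: "card P > 0"
    using assms(2,3) by (simp add: P_def card_nsets zero_less_binomial_iff)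
  then have "P \<noteq> {}" by auto
  have \<eta>: "\<eta> > 0" using \<kappa> finP by (simp add: \<eta>_def P_def)
  obtain \<theta> where \<theta>: "(\<Prod>e\<in>P. \<kappa> e / 2) * cos (\<theta> * real (card P)) = \<eta>"
    unfolding \<eta>_def using exists_phase_aligning[OF cardP] by blast
  obtain N where N: "prime N" "2 * d\<^sup>2 + d + nat \<lceil>C / \<eta>\<rceil> < N"
    using bigger_prime by blast
  have N0: "N > 0" using N by simp
  have "C / \<eta> < real N" using N(2) by linarith
  then have CN: "C < \<eta> * real N" using \<eta> by (simp add: field_simps)
  define c where "c s = real (card (twist_solutions d N V s)) / real N ^ card V" for s
  define f where "f s = W s * cos (\<theta> * of_int (\<Sum>e\<in>P. s e)) * c s" for s
  have "complex_of_real (\<Sum>k\<in>V \<rightarrow>\<^sub>E {..<d * N * N}.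
      \<Prod>e\<in>P. q e + \<kappa> e * cos (twist_phase d N (k (Min e)) (k (Max e)) + \<theta>)) =
    (\<Sum>k\<in>V \<rightarrow>\<^sub>E {..<d * N * N}. \<Sum>s\<in>S. of_real (W s) *
      cis (\<Sum>e\<in>P. of_int (s e) * (twist_phase d N (k (Min e)) (k (Max e)) + \<theta>)))"
    unfolding of_real_sum prod_cos_expand[OF finP] S_def W_def by simp
  also have "\<dots> = (\<Sum>s\<in>S. of_real (W s) * (\<Sum>k\<in>V \<rightarrow>\<^sub>E {..<d * N * N}.
      cis (\<Sum>e\<in>P. of_int (s e) * (twist_phase d N (k (Min e)) (k (Max e)) + \<theta>))))"
    unfolding sum_distrib_left by (rule sum.swap)
  also have "\<dots> = (\<Sum>s\<in>S. of_real (W s) * (cis (\<theta> * of_int (\<Sum>e\<in>P. s e)) *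
      of_nat ((d * N) ^ card V * card (twist_solutions d N V s))))"
    by (simp only: P_def sum_cis_twist_phase[OF assms(1,3) N0])
  finally have "(\<Sum>k\<in>V \<rightarrow>\<^sub>E {..<d * N * N}.
      \<Prod>e\<in>P. q e + \<kappa> e * cos (twist_phase d N (k (Min e)) (k (Max e)) + \<theta>)) =
    Re (\<Sum>s\<in>S. of_real (W s) * (cis (\<theta> * of_int (\<Sum>e\<in>P. s e)) *
      of_nat ((d * N) ^ card V * card (twist_solutions d N V s))))"
    by (subst Re_complex_of_real[symmetric], simp only:)
  also have "\<dots> = (\<Sum>s\<in>S. f s) * real (d * N * N) ^ card V"
    unfolding Re_sum sum_distrib_right using N0
    by (intro sum.cong refl) (simp add: f_def c_def power_mult_distrib)
  finally have avg: "(\<Sum>k\<in>V \<rightarrow>\<^sub>E {..<d * N * N}.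
      \<Prod>e\<in>P. q e + \<kappa> e * cos (twist_phase d N (k (Min e)) (k (Max e)) + \<theta>)) /
      real (d * N * N) ^ card V = (\<Sum>s\<in>S. f s)"
    using N0 assms(3) by simp
  define zero one :: "nat set \<Rightarrow> int" where "zero = (\<lambda>e\<in>P. 0)" and "one = (\<lambda>e\<in>P. 1)"
  have S: "zero \<in> S" "one \<in> S" "zero \<noteq> one"
    using \<open>P \<noteq> {}\<close> by (auto simp: S_def zero_def one_def fun_eq_iff)
  have fzero: "f zero = (\<Prod>e\<in>P. q e)"
    using N0 assms(1) by (simp add: f_def c_def W_def zero_def P_def card_twist_solutions_zero)
  have fone: "\<eta> / real N \<le> f one"
  proof -
    have "real N ^ (card V - 1) \<le> real (card (twist_solutions d N V one))"
      using card_twist_solutions_const_ge[OF assms(1) \<open>V \<noteq> {}\<close> assms(2) N0, of one 1]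
      by (simp add: one_def P_def flip: of_nat_power)
    then have "real N ^ (card V - 1) / real N ^ card V \<le> c one"
      unfolding c_def by (rule divide_right_mono) simp
    moreover have "real N ^ card V = real N ^ (card V - 1) * real N"
      using assms(2) by (cases "card V") auto
    ultimately have "1 / real N \<le> c one" using N0 by simp
    then have "\<eta> * (1 / real N) \<le> \<eta> * c one" using \<eta> by (intro mult_left_mono) auto
    also have "\<dots> = f one" using \<theta> by (simp add: f_def W_def one_def)
    finally show ?thesis by simp
  qed
  have frest: "- \<bar>W s\<bar> / (real N)\<^sup>2 \<le> f s" if s: "s \<in> S - {zero} - {one}" for s
  proof (cases "s = (\<lambda>e\<in>P. -1)")
    case True
    have "f s = \<eta> * c s"
      using \<theta> by (simp add: True f_def W_def)
    then have "0 \<le> f s" using \<eta> by (simp add: c_def)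
    moreover have "- \<bar>W s\<bar> / (real N)\<^sup>2 \<le> 0" by (intro divide_nonpos_nonneg) auto
    ultimately show ?thesis by linarith
  next
    case False
    have "card (twist_solutions d N V s) \<le> N ^ (card V - 2)"
      using s False N by (intro card_twist_solutions_nonconst assms(1,2))
        (auto simp: S_def P_def zero_def one_def)
    then have "real (card (twist_solutions d N V s)) \<le> real N ^ (card V - 2)"
      by (simp flip: of_nat_power)
    then have "c s \<le> real N ^ (card V - 2) / real N ^ card V"
      unfolding c_def by (rule divide_right_mono) simp
    moreover have "real N ^ card V = real N ^ (card V - 2) * (real N)\<^sup>2"
    proof -
      have "card V = (card V - 2) + 2" using assms(2,3) by simp
      then show ?thesis by (metis power_add)
    qed
    ultimately have cs: "c s \<le> 1 / (real N)\<^sup>2" using N0 by simp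
    have "\<bar>f s\<bar> \<le> \<bar>W s\<bar> * 1 * (1 / (real N)\<^sup>2)"
      unfolding f_def abs_mult using cs by (intro mult_mono) (auto simp: c_def)
    then show ?thesis by simp
  qed
  have "(\<Sum>s\<in>S - {zero} - {one}. \<bar>W s\<bar>) \<le> C"
    unfolding C_def by (rule sum_mono2) (use finS in auto)
  then have "- C / (real N)\<^sup>2 \<le> - (\<Sum>s\<in>S - {zero} - {one}. \<bar>W s\<bar>) / (real N)\<^sup>2"
    by (intro divide_right_mono) auto
  also have "\<dots> = (\<Sum>s\<in>S - {zero} - {one}. - \<bar>W s\<bar> / (real N)\<^sup>2)"
    by (simp add: sum_divide_distrib sum_negf)
  also have "\<dots> \<le> (\<Sum>s\<in>S - {zero} - {one}. f s)"
    by (rule sum_mono) (rule frest)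
  finally have rest: "- C / (real N)\<^sup>2 \<le> (\<Sum>s\<in>S - {zero} - {one}. f s)" .
  have "C / (real N)\<^sup>2 < \<eta> / real N"
    using CN N0 by (simp add: field_simps power2_eq_square)
  then have "(\<Prod>e\<in>P. q e) < f zero + (f one + (\<Sum>s\<in>S - {zero} - {one}. f s))"
    using fzero fone rest by simp
  also have "\<dots> = (\<Sum>s\<in>S. f s)"
    using S finS by (simp add: sum.remove[of S zero] sum.remove[of "S - {zero}" one])
  finally show ?thesis
    using N avg unfolding P_def by (intro exI[of _ N] exI[of _ \<theta>]) simp
qed

theorem theorem1p3:
  fixes m :: nat and E :: "nat set set" and p \<delta> :: real
  assumes "E \<subseteq> nsets {1..m} 2"
    and "m \<ge> 3"
    and "0 < p" and "p < 1"
    and "0 < \<delta>" and "\<delta> \<le> min p (1 - p)"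
  shows "\<exists>\<Delta> :: real \<times> real \<Rightarrow> real.
     graphon_kernel \<Delta> \<and> \<Delta> ` unit_square \<subseteq> {-\<delta>..\<delta>} \<and>
     edge_density \<Delta> = 0 \<and>
     edge_density (\<lambda>z. const_graphon p z + \<Delta> z) = edge_density (const_graphon p) \<and>
     edge_density (const_graphon p) = p \<and>
     induced_density m E (\<lambda>z. const_graphon p z + \<Delta> z) > induced_density m E (const_graphon p) \<and>
     induced_density m E (const_graphon p) = rand_density m E p"
proof -
  define d where "d = m - 1"
  define P where "P = nsets {1..m} 2"
  define q where "q e = (if e \<in> E then p else 1 - p)" for e
  define \<kappa> where "\<kappa> e = (if e \<in> E then \<delta> else - \<delta>)" for e
  have d: "d + 1 = card {1..m}" "d > 1" using assms(2) by (auto simp: d_def)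
  have \<kappa>: "\<kappa> e \<noteq> 0" for e using assms(5) by (simp add: \<kappa>_def)
  obtain N \<theta> where N: "prime N" "N > d" and gain:
    "(\<Prod>e\<in>P. q e) < (\<Sum>k\<in>{1..m} \<rightarrow>\<^sub>E {..<d * N * N}.
      \<Prod>e\<in>P. q e + \<kappa> e * cos (twist_phase d N (k (Min e)) (k (Max e)) + \<theta>)) / real (d * N * N) ^ card {1..m}"
    using twist_average_exceeds[of "{1..m}" d \<kappa> q, OF _ d(1) _ \<kappa>] d(2) unfolding P_def
    by (meson finite_atLeastAtMost less_trans zero_less_one)
  define K where "K = d * N * N"
  have N0: "N > 0" and K: "K > 0" using N d by (auto simp: K_def)
  have ndvd: "\<not> d dvd N" using N d by (auto simp: prime_nat_iff)
  define A where "A k l = \<delta> * cos (twist_phase d N k l + \<theta>)" for k l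
  define \<Delta> where "\<Delta> = step_kernel K A"
  have range: "\<Delta> z \<in> {-\<delta>..\<delta>}" for z
  proof -
    have "\<bar>\<Delta> z\<bar> \<le> \<delta> * 1"
      unfolding \<Delta>_def step_kernel_def A_def abs_mult using assms(5) by (intro mult_mono) auto
    then show ?thesis by (auto simp: abs_le_iff)
  qed
  have "graphon_kernel \<Delta>"
    unfolding graphon_kernel_def
  proof (intro conjI ballI)
    show "\<Delta> \<in> borel_measurable (restrict_space borel unit_square)"
      unfolding \<Delta>_def by (rule measurable_restrict_space1[OF step_kernel_measurable])
    show "bounded (\<Delta> ` unit_square)"
      by (rule bounded_subset[of "{-\<delta>..\<delta>}"]) (use range in auto)
    show "\<Delta> (x, y) = \<Delta> (y, x)" for x y
      by (simp add: \<Delta>_def step_kernel_def A_def twist_phase_commute)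
  qed
  \<comment> \<open>All kernels involved are step kernels; the constant one has a single part.\<close>
  have const: "const_graphon p = step_kernel 1 (\<lambda>_ _. p)"
    by (simp add: const_graphon_def step_kernel_def fun_eq_iff)
  have shift: "(\<lambda>z. const_graphon p z + \<Delta> z) = step_kernel K (\<lambda>k l. p + A k l)"
    by (simp add: const_graphon_def \<Delta>_def step_kernel_def fun_eq_iff)
  have "(\<Sum>k<K. A k l) = 0" for l
    using sum_cos_twist_phase_eq_0[OF _ N0 ndvd, of l \<theta>] d
    by (simp add: A_def K_def flip: sum_distrib_left)
  then have sumA: "(\<Sum>k<K. \<Sum>l<K. A k l) = 0"
    by (subst sum.swap) simp
  have e0: "edge_density \<Delta> = 0"
    using K sumA by (simp add: \<Delta>_def edge_density_step_kernel)
  have ep: "edge_density (const_graphon p) = p"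
    by (simp add: const edge_density_step_kernel)
  have es: "edge_density (\<lambda>z. const_graphon p z + \<Delta> z) = p"
    using K sumA by (simp add: shift edge_density_step_kernel sum.distrib power2_eq_square)
  have ind: "induced_density m E (const_graphon p) = (\<Prod>e\<in>P. q e)"
    using assms(1) by (simp add: const induced_density_step_kernel P_def q_def card_PiE)
  have "finite P" by (simp add: P_def finite_imp_finite_nsets)
  have rand: "(\<Prod>e\<in>P. q e) = rand_density m E p"
  proof -
    have "(\<Prod>e\<in>P. q e) = (\<Prod>e\<in>P - E. q e) * (\<Prod>e\<in>E. q e)"
      using assms(1) \<open>finite P\<close> by (intro prod.subset_diff) (auto simp: P_def)
    moreover have "card (P - E) = (m choose 2) - card E"
      using assms(1) \<open>finite P\<close> by (simp add: P_def card_Diff_subset finite_subset card_nsets)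
    ultimately show ?thesis by (simp add: rand_density_def q_def)
  qed
  have "induced_density m E (\<lambda>z. const_graphon p z + \<Delta> z) =
      (\<Sum>k\<in>{1..m} \<rightarrow>\<^sub>E {..<K}.
        \<Prod>e\<in>P. q e + \<kappa> e * cos (twist_phase d N (k (Min e)) (k (Max e)) + \<theta>)) / real K ^ m"
    unfolding shift induced_density_step_kernel[OF K assms(1)] P_def[symmetric]
    by (intro arg_cong2[where f = divide] sum.cong prod.cong refl)
      (simp add: q_def \<kappa>_def A_def)
  then have "induced_density m E (const_graphon p) < induced_density m E (\<lambda>z. const_graphon p z + \<Delta> z)"
    using gain ind by (simp add: K_def)
  with \<open>graphon_kernel \<Delta>\<close> range e0 ep es ind rand show ?thesis
    by (intro exI[of _ \<Delta>]) auto
qed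

end
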